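(* Let $n\ge 2$. (i) Let $s\in(0,1)$, let $C(s)\ge 1$, and let $u:\mathbb{B}^n\to(0,\infty)$ be a Harnack function on $\mathbb{B}^n$ with parameters $s$ and $C(s)$. Then for all $x,y\in\mathbb{B}^n$ $$u(x)\le C(s)^{1+t}\,u(y),\qquad t=\frac{\log\big((1+r)/(1-r)\big)}{\log\big((1+s)/(1-s)\big)},$$ where $r=\tanh\big(\rho_{\mathbb{B}^n}(x,y)/2\big)$. (ii) If $u:\mathbb{B}^n\to(0,\infty)$ is a positive harmonic function, $x\in\mathbb{B}^n$, $s\in(0,1)$ and $y\in S^{n-1}(x,s(1-|x|))$, then $$u(x)\le\frac{1}{1-s^2}\left(\frac{1+s}{1-s}\right)^n u(y),\qquad\text{and}\qquad s<\exp\big(\rho_{\mathbb{B}^n}(x,y)\big)-1.$$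
   Context: $B^n(x,r)=\{y\in\mathbb{R}^n:|y-x|<r\}$, $\overline{B}^n(x,r)=\{y\in\mathbb{R}^n:|y-x|\le r\}$, $S^{n-1}(x,r)=\{y\in\mathbb{R}^n:|y-x|=r\}$, $\mathbb{B}^n=B^n(0,1)$. Harnack function: for a proper subdomain $G$ of $\mathbb{R}^n$, $s\in(0,1)$ and $C(s)\ge1$, a continuous function $u:G\to[0,\infty)$ is a Harnack function with parameters $s$ and $C(s)$ if $$\max_{B_x}u(z)\le C(s)\min_{B_x}u(z)$$ whenever $B^n(x,r)\subset G$ and $B_x=\overline{B}^n(x,sr)$. The hyperbolic metric $\rho_{\mathbb{B}^n}$ of the unit ball is given by $\sinh^2\frac{\rho_{\mathbb{B}^n}(x,y)}{2}=\frac{|x-y|^2}{(1-|x|^2)(1-|y|^2)}$ for $x,y\in\mathbb{B}^n$. A real function is harmonic if it is twice continuously differentiable and satisfies Laplace's equation. *)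

theory Defs
  imports "HOL-Analysis.Analysis"
begin

text \<open>
  Functions on a subset \<open>G\<close> of \<open>real ^ 'n\<close> are total functions of which only the values
  on \<open>G\<close> matter.
\<close>

definition proper_subdomain :: "(real ^ 'n) set \<Rightarrow> bool" where
  "proper_subdomain G \<longleftrightarrow> open G \<and> connected G \<and> G \<noteq> {} \<and> G \<noteq> UNIV"

text \<open>
  The closed ball of radius \<open>s * r\<close> is a nonempty compact subset of \<open>G\<close> (as \<open>s < 1\<close>), and \<open>u\<close> is
  continuous on \<open>G\<close>, so the supremum and infimum below are a maximum and a minimum.
\<close>

definition harnack_function :: "(real ^ 'n) set \<Rightarrow> real \<Rightarrow> real \<Rightarrow> (real ^ 'n \<Rightarrow> real) \<Rightarrow> bool" where
  "harnack_function G s C u \<longleftrightarrow>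
     proper_subdomain G \<and> 0 < s \<and> s < 1 \<and> 1 \<le> C \<and>
     continuous_on G u \<and> (\<forall>z\<in>G. 0 \<le> u z) \<and>
     (\<forall>x r. 0 < r \<and> ball x r \<subseteq> G \<longrightarrow>
        (SUP z\<in>cball x (s * r). u z) \<le> C * (INF z\<in>cball x (s * r). u z))"

definition hyp_dist :: "real ^ 'n \<Rightarrow> real ^ 'n \<Rightarrow> real" where
  "hyp_dist x y =
     (THE d. 0 \<le> d \<and>
        (sinh (d / 2))\<^sup>2 = (norm (x - y))\<^sup>2 / ((1 - (norm x)\<^sup>2) * (1 - (norm y)\<^sup>2)))"

lemma hyp_dist_ex1:
  fixes q :: real
  assumes "0 \<le> q"
  shows "\<exists>!d::real. 0 \<le> d \<and> (sinh (d / 2))\<^sup>2 = q"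
proof (rule ex1I[of _ "2 * arsinh (sqrt q)"])
  show "0 \<le> 2 * arsinh (sqrt q) \<and> (sinh (2 * arsinh (sqrt q) / 2))\<^sup>2 = q"
    using assms sinh_real_nonneg_iff[of "arsinh (sqrt q)"] by (simp add: sinh_arsinh_real)
next
  fix d :: real
  assume d: "0 \<le> d \<and> (sinh (d / 2))\<^sup>2 = q"
  then have "sinh (d / 2) = sqrt q"
    by (metis divide_nonneg_pos real_sqrt_unique sinh_real_nonneg_iff zero_less_numeral)
  then have "d / 2 = arsinh (sqrt q)"
    by (metis arsinh_sinh_real)
  then show "d = 2 * arsinh (sqrt q)"
    by simp
qed

text \<open>The definite description is well defined on the unit ball.\<close>

lemma
  fixes x y :: "real ^ 'n"
  assumes "x \<in> ball 0 1" "y \<in> ball 0 1"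
  shows hyp_dist_nonneg: "0 \<le> hyp_dist x y"
    and sinh_hyp_dist:
      "(sinh (hyp_dist x y / 2))\<^sup>2 = (norm (x - y))\<^sup>2 / ((1 - (norm x)\<^sup>2) * (1 - (norm y)\<^sup>2))"
proof -
  have "0 \<le> (norm (x - y))\<^sup>2 / ((1 - (norm x)\<^sup>2) * (1 - (norm y)\<^sup>2))"
    using assms by (simp add: abs_square_le_1 less_imp_le)
  from theI'[OF hyp_dist_ex1[OF this]]
  show "0 \<le> hyp_dist x y"
    and "(sinh (hyp_dist x y / 2))\<^sup>2 = (norm (x - y))\<^sup>2 / ((1 - (norm x)\<^sup>2) * (1 - (norm y)\<^sup>2))"
    unfolding hyp_dist_def by blast+
qed

text \<open>Intended for open \<open>G\<close>; \<open>D\<close> and \<open>H\<close> are the first and second Frechet derivatives of \<open>u\<close>.\<close>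

definition twice_cont_diff_on :: "(real ^ 'n) set \<Rightarrow> (real ^ 'n \<Rightarrow> real) \<Rightarrow> bool" where
  "twice_cont_diff_on G u \<longleftrightarrow>
     (\<exists>(D :: real ^ 'n \<Rightarrow> (real ^ 'n) \<Rightarrow>\<^sub>L real)
       (H :: real ^ 'n \<Rightarrow> (real ^ 'n) \<Rightarrow>\<^sub>L (real ^ 'n) \<Rightarrow>\<^sub>L real).
        (\<forall>x\<in>G. (u has_derivative blinfun_apply (D x)) (at x)) \<and>
        (\<forall>x\<in>G. (D has_derivative blinfun_apply (H x)) (at x)) \<and>
        continuous_on G H)"

definition partial_derivative :: "'n \<Rightarrow> (real ^ 'n \<Rightarrow> real) \<Rightarrow> real ^ 'n \<Rightarrow> real" where
  "partial_derivative i f x = deriv (\<lambda>t. f (x + t *\<^sub>R axis i 1)) 0"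

definition laplacian :: "(real ^ 'n \<Rightarrow> real) \<Rightarrow> real ^ 'n \<Rightarrow> real" where
  "laplacian u x = (\<Sum>i\<in>UNIV. partial_derivative i (partial_derivative i u) x)"

definition harmonic_function_on :: "(real ^ 'n) set \<Rightarrow> (real ^ 'n \<Rightarrow> real) \<Rightarrow> bool" where
  "harmonic_function_on G u \<longleftrightarrow>
     open G \<and> twice_cont_diff_on G u \<and> (\<forall>x\<in>G. laplacian u x = 0)"

end

theory Submission
  imports Defs
begin

text \<open>
  Part (i). Write \<open>\<rho>\<close> for the hyperbolic distance. A closed hyperbolic ball of radius \<open>artanh s\<close> is
  contained in a closed Euclidean ball about some \<open>c\<close> with radius \<open>s * (1 - norm c)\<close>
  (\<open>hyp_ball_subset_cball\<close>), so the Harnack condition compares, at the cost of one factor \<open>C\<close>, any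
  two points with \<open>\<rho> x y \<le> 2 * artanh s\<close>: take the ball about their midpoint. The geodesic from
  \<open>x\<close> to \<open>y\<close> is covered by at most \<open>1 + \<rho> x y / (2 * artanh s)\<close> pieces of that length, and
  this number is \<open>1 + t\<close>, since \<open>ln ((1 + r) / (1 - r)) = 2 * artanh r\<close> and
  \<open>artanh (tanh (\<rho> x y / 2)) = \<rho> x y / 2\<close>. Points on the geodesic are found in the hyperboloid model
  (\<open>hyp_geodesic_point\<close>).

  Part (ii). The Harnack inequality comes from the mean value property over balls
  (\<open>harmonic_mean_value\<close>). The mean of \<open>u\<close> over the ball of radius \<open>r\<close> is constant in \<open>r\<close>, because
  its derivative is, up to a factor, the integral of a divergence of Lipschitz fields that vanish outside the ball,
  and such integrals are zero by translation invariance of Lebesgue measure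
  (\<open>integral_directional_derivative_eq_0\<close>). For positive \<open>u\<close>, comparing the mean values over two
  internally tangent balls gives \<open>(r - dist p q) ^ n * u p \<le> r ^ n * u q\<close>. Applied to many small
  steps on the segment from \<open>x\<close> to \<open>y\<close> these factors telescope, and in the limit
  \<open>(1 - s) ^ n * u x \<le> u y\<close> (\<open>harmonic_harnack\<close>). The constant in the theorem is larger than
  \<open>(1 - s) ^ (- n)\<close>. The remaining inequality \<open>ln (1 + s) < \<rho> x y\<close> is read off from the
  formula for the distance (\<open>hyp_dist_gt_ln\<close>).
\<close>

section \<open>Hyperbolic geometry of the unit ball\<close>

text \<open>
  These are the time and space components of the point of the upper sheet
  \<open>T\<^sup>2 - Z \<bullet> Z = 1\<close> of the hyperboloid that corresponds to \<open>x\<close> under stereographic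
  projection from \<open>(-1, 0)\<close>. In this model the points of a geodesic are explicit linear combinations
  of its end points.
\<close>

definition hyp_time :: "real ^ 'n \<Rightarrow> real" where
  "hyp_time x = (1 + (norm x)\<^sup>2) / (1 - (norm x)\<^sup>2)"

definition hyp_space :: "real ^ 'n \<Rightarrow> real ^ 'n" where
  "hyp_space x = (2 / (1 - (norm x)\<^sup>2)) *\<^sub>R x"

lemma one_minus_norm_sq_pos:
  fixes x :: "real ^ 'n"
  assumes "x \<in> ball 0 1"
  shows "0 < 1 - (norm x)\<^sup>2"
  using assms by (simp add: abs_square_less_1)

lemma hyp_dist_commute: "hyp_dist x y = hyp_dist y x"
  unfolding hyp_dist_def by (simp add: norm_minus_commute mult.commute)

lemma cosh_hyp_dist:
  fixes x y :: "real ^ 'n"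
  assumes "x \<in> ball 0 1" "y \<in> ball 0 1"
  shows "cosh (hyp_dist x y) =
    1 + 2 * (norm (x - y))\<^sup>2 / ((1 - (norm x)\<^sup>2) * (1 - (norm y)\<^sup>2))"
  using cosh_double[of "hyp_dist x y / 2"] sinh_hyp_dist[OF assms]
  by (simp add: cosh_square_eq)

text \<open>
  The projection is an isometry onto the hyperboloid, on which the hyperbolic cosine of a
  distance is the Lorentz product.
\<close>

lemma cosh_hyp_dist_hyperboloid:
  fixes x y :: "real ^ 'n"
  assumes "x \<in> ball 0 1" "y \<in> ball 0 1"
  shows "cosh (hyp_dist x y) = hyp_time x * hyp_time y - hyp_space x \<bullet> hyp_space y"
proof -
  define p q w where "p = (norm x)\<^sup>2" and "q = (norm y)\<^sup>2" and "w = x \<bullet> y"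
  have "p < 1" "q < 1"
    using one_minus_norm_sq_pos[OF assms(1)] one_minus_norm_sq_pos[OF assms(2)]
    by (auto simp: p_def q_def)
  moreover have "(norm (x - y))\<^sup>2 = p + q - 2 * w"
    by (simp add: p_def q_def w_def power2_norm_eq_inner inner_diff inner_commute)
  ultimately show ?thesis
    unfolding cosh_hyp_dist[OF assms] hyp_time_def hyp_space_def
    by (simp add: divide_simps flip: p_def q_def w_def) (simp add: algebra_simps)
qed

lemma hyp_dist_eqI:
  fixes x y :: "real ^ 'n"
  assumes "x \<in> ball 0 1" "y \<in> ball 0 1" "0 \<le> d" "cosh (hyp_dist x y) = cosh d"
  shows "hyp_dist x y = d"
  using assms hyp_dist_nonneg[OF assms(1,2)]
  by (metis cosh_real_nonneg_le_iff order.antisym order.refl)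

lemma hyp_time_pos: "x \<in> ball 0 1 \<Longrightarrow> 0 < hyp_time x"
  using one_minus_norm_sq_pos[of x] by (simp add: hyp_time_def add_pos_nonneg)

lemma hyp_time_sq:
  assumes "x \<in> ball 0 1"
  shows "(hyp_time x)\<^sup>2 = 1 + hyp_space x \<bullet> hyp_space x"
proof -
  define p where "p = (norm x)\<^sup>2"
  have "p < 1"
    using one_minus_norm_sq_pos[OF assms] by (simp add: p_def)
  moreover have "hyp_space x \<bullet> hyp_space x = 4 * p / (1 - p)\<^sup>2"
    by (simp add: hyp_space_def p_def power2_norm_eq_inner power_divide)
      (simp add: power2_eq_square)
  ultimately show ?thesis
    unfolding hyp_time_def p_def[symmetric]
    by (simp add: divide_simps power2_eq_square) (simp add: algebra_simps)
qed

lemma hyperboloid_point_in_ball: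
  fixes Z :: "real ^ 'n"
  assumes T: "0 < T" "T\<^sup>2 = 1 + Z \<bullet> Z"
  obtains z where "z \<in> ball 0 1" "hyp_time z = T" "hyp_space z = Z"
proof
  define z where "z = (1 / (1 + T)) *\<^sub>R Z"
  have "(norm z)\<^sup>2 = (T\<^sup>2 - 1) / (1 + T)\<^sup>2"
    using T by (simp add: z_def power_divide power2_norm_eq_inner)
  also have "\<dots> = (T - 1) / (T + 1)"
    using T(1) by (simp add: divide_simps power2_eq_square) (simp add: algebra_simps)
  finally have nz: "(norm z)\<^sup>2 = (T - 1) / (T + 1)" .
  also have "\<dots> < 1"
    using T(1) by simp
  finally show "z \<in> ball 0 1"
    by (simp add: abs_square_less_1)
  show "hyp_time z = T"
    unfolding hyp_time_def nz using T(1) by (simp add: field_simps)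
  have "2 / (1 - (norm z)\<^sup>2) = 1 + T"
    unfolding nz using T(1) by (simp add: field_simps)
  then show "hyp_space z = Z"
    using T(1) unfolding hyp_space_def by (simp add: z_def)
qed

text \<open>
  With \<open>X\<close> and \<open>Y\<close> the hyperboloid points of \<open>x\<close> and \<open>y\<close>, and \<open>r\<close> their distance, the
  geodesic from \<open>X\<close> to \<open>Y\<close> passes at distance \<open>a\<close> from \<open>X\<close> through
  \<open>(sinh (r - a) X + sinh a Y) / sinh r\<close>. The addition theorems for \<open>sinh\<close> and \<open>cosh\<close> show
  that this point lies on the hyperboloid and has the required distances from \<open>X\<close> and \<open>Y\<close>.
\<close>

lemma hyp_geodesic_point:
  fixes x y :: "real ^ 'n"
  assumes x: "x \<in> ball 0 1" and y: "y \<in> ball 0 1"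
    and a: "0 \<le> a" "a \<le> hyp_dist x y"
  obtains z where "z \<in> ball 0 1" "hyp_dist x z = a" "hyp_dist z y = hyp_dist x y - a"
proof (cases "hyp_dist x y = 0")
  \<comment> \<open>Here the formula for the point would divide by 0.\<close>
  case True
  moreover have "hyp_dist x x = 0"
    using x by (intro hyp_dist_eqI) (simp_all add: cosh_hyp_dist)
  ultimately show ?thesis
    using that[of x] x a by simp
next
  case False
  define r b where "r = hyp_dist x y" and "b = r - a"
  have r: "0 < r" and b: "0 \<le> b" and rab: "r = a + b"
    using False hyp_dist_nonneg[OF x y] a by (simp_all add: r_def b_def)
  have shr: "0 < sinh r" and sha: "0 \<le> sinh a" and shb: "0 \<le> sinh b"
    using r a b by simp_all
  define \<alpha> \<beta> where "\<alpha> = sinh b / sinh r" and "\<beta> = sinh a / sinh r"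
  define T Z where "T = \<alpha> * hyp_time x + \<beta> * hyp_time y"
    and "Z = \<alpha> *\<^sub>R hyp_space x + \<beta> *\<^sub>R hyp_space y"
  note defs = \<alpha>_def \<beta>_def
  have ca: "cosh a ^ 2 = 1 + sinh a ^ 2" and cb: "cosh b ^ 2 = 1 + sinh b ^ 2"
    by (simp_all add: cosh_square_eq)
  have xy: "cosh r = hyp_time x * hyp_time y - hyp_space x \<bullet> hyp_space y"
    unfolding r_def by (rule cosh_hyp_dist_hyperboloid[OF x y])
  \<comment> \<open>The Lorentz products of the candidate with X, with Y and, combining these two, with itself.\<close>
  have \<alpha>\<beta>a: "\<alpha> + \<beta> * cosh r = cosh a"
  proof -
    have "sinh b + sinh a * cosh r = cosh a * sinh r"
      unfolding rab sinh_add cosh_add using ca by algebra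
    then show ?thesis
      using shr by (simp add: defs field_simps)
  qed
  have \<alpha>\<beta>b: "\<alpha> * cosh r + \<beta> = cosh b"
  proof -
    have "sinh b * cosh r + sinh a = cosh b * sinh r"
      unfolding rab sinh_add cosh_add using cb by algebra
    then show ?thesis
      using shr by (simp add: defs field_simps)
  qed
  have \<alpha>\<beta>1: "\<alpha> * cosh a + \<beta> * cosh b = 1"
  proof -
    have "sinh b * cosh a + sinh a * cosh b = sinh r"
      unfolding rab sinh_add by simp
    then show ?thesis
      using shr by (simp add: defs field_simps)
  qed
  have "0 < \<alpha> \<or> 0 < \<beta>"
    using \<alpha>\<beta>1 sha shb shr by (auto simp: defs zero_less_divide_iff)
  moreover have "0 \<le> \<alpha>" "0 \<le> \<beta>"
    using sha shb shr by (simp_all add: defs)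
  ultimately have "0 < T"
    using hyp_time_pos[OF x] hyp_time_pos[OF y]
    unfolding T_def by (auto intro: add_pos_nonneg add_nonneg_pos)
  moreover have "T\<^sup>2 = 1 + Z \<bullet> Z"
  proof -
    have "T\<^sup>2 - Z \<bullet> Z = \<alpha> * (\<alpha> + \<beta> * cosh r) + \<beta> * (\<alpha> * cosh r + \<beta>)"
      unfolding T_def Z_def xy inner_add inner_scaleR_left inner_scaleR_right
        inner_commute[of "hyp_space y" "hyp_space x"]
      using hyp_time_sq[OF x] hyp_time_sq[OF y] by algebra
    then show ?thesis
      unfolding \<alpha>\<beta>a \<alpha>\<beta>b \<alpha>\<beta>1 by simp
  qed
  ultimately obtain z where z: "z \<in> ball 0 1" "hyp_time z = T" "hyp_space z = Z"
    by (rule hyperboloid_point_in_ball)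
  have "cosh (hyp_dist x z) = \<alpha> + \<beta> * cosh r"
    unfolding cosh_hyp_dist_hyperboloid[OF x z(1)] z T_def Z_def xy inner_add_right inner_scaleR_right
    using hyp_time_sq[OF x] by algebra
  moreover have "cosh (hyp_dist z y) = \<alpha> * cosh r + \<beta>"
    unfolding cosh_hyp_dist_hyperboloid[OF z(1) y] z T_def Z_def xy inner_add_left inner_scaleR_left
    using hyp_time_sq[OF y] by algebra
  ultimately have "hyp_dist x z = a" "hyp_dist z y = b"
    using x y z(1) a b \<alpha>\<beta>a \<alpha>\<beta>b by (auto intro!: hyp_dist_eqI)
  then show ?thesis
    using that[OF z(1)] by (simp add: b_def r_def)
qed

text \<open>
  A hyperbolic ball is a Euclidean ball, in general with another center \<open>c\<close>, found by completing the square
  in \<open>(norm (m - z))\<^sup>2 \<le> K * (1 - (norm z)\<^sup>2)\<close>. Its Euclidean radius is at most the fraction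
  \<open>tanh a\<close> of the distance from \<open>c\<close> to the unit sphere; this comes down to
  \<open>0 \<le> (1 - norm m)\<^sup>2\<close>.
\<close>

lemma hyp_ball_subset_cball:
  fixes m :: "real ^ 'n"
  assumes m: "m \<in> ball 0 1" and a: "0 \<le> a"
  obtains c where "c \<in> ball 0 1"
    "\<And>z. z \<in> ball 0 1 \<Longrightarrow> hyp_dist m z \<le> a \<Longrightarrow> z \<in> cball c (tanh a * (1 - norm c))"
proof
  define \<mu> S where "\<mu> = norm m" and "S = (cosh a - 1) / 2"
  define K where "K = S * (1 - \<mu>\<^sup>2)"
  define c where "c = (1 / (1 + K)) *\<^sub>R m"
  have \<mu>: "0 \<le> \<mu>" "\<mu> < 1" and \<mu>2: "0 < 1 - \<mu>\<^sup>2"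
    using m one_minus_norm_sq_pos[OF m] by (simp_all add: \<mu>_def)
  have S: "0 \<le> S"
    by (simp add: S_def cosh_real_ge_1)
  then have K: "0 \<le> K"
    using \<mu>2 by (simp add: K_def)
  have nc: "norm c = \<mu> / (1 + K)"
    using K by (simp add: c_def \<mu>_def)
  also have "\<dots> \<le> \<mu>"
    using K \<mu> by (simp add: pos_divide_le_eq algebra_simps)
  finally show c: "c \<in> ball 0 1"
    using \<mu> by simp
  fix z :: "real ^ 'n"
  assume z: "z \<in> ball 0 1" and mz: "hyp_dist m z \<le> a"
  define \<zeta> w where "\<zeta> = (norm z)\<^sup>2" and "w = m \<bullet> z"
  have \<zeta>: "0 < 1 - \<zeta>"
    using one_minus_norm_sq_pos[OF z] by (simp add: \<zeta>_def)
  have "cosh (hyp_dist m z) \<le> cosh a"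
    using mz a hyp_dist_nonneg[OF m z] by (simp add: cosh_real_nonneg_le_iff)
  then have "2 * (norm (m - z))\<^sup>2 / ((1 - \<mu>\<^sup>2) * (1 - \<zeta>)) \<le> 2 * S"
    unfolding cosh_hyp_dist[OF m z] by (simp add: S_def \<mu>_def \<zeta>_def)
  then have "(norm (m - z))\<^sup>2 \<le> K * (1 - \<zeta>)"
    using \<mu>2 \<zeta> by (simp add: pos_divide_le_eq K_def mult.assoc)
  moreover have "(norm (m - z))\<^sup>2 = \<mu>\<^sup>2 + \<zeta> - 2 * w"
    by (simp add: \<mu>_def \<zeta>_def w_def power2_norm_eq_inner inner_diff inner_commute)
  ultimately have "(1 + K) * \<zeta> - 2 * w + \<mu>\<^sup>2 \<le> K"
    by (simp add: algebra_simps)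
  then have le: "(1 + K) * ((1 + K) * \<zeta> - 2 * w + \<mu>\<^sup>2) \<le> (1 + K) * K"
    using K by (intro mult_left_mono) auto
  have "(1 + K) *\<^sub>R (z - c) = (1 + K) *\<^sub>R z - m"
    using K by (simp add: c_def algebra_simps)
  then have "((1 + K) * norm (z - c))\<^sup>2 = (norm ((1 + K) *\<^sub>R z - m))\<^sup>2"
    using K by (metis abs_of_nonneg add_nonneg_nonneg norm_scaleR zero_le_one)
  also have "\<dots> = (1 + K)\<^sup>2 * \<zeta> - 2 * (1 + K) * w + \<mu>\<^sup>2"
    unfolding \<mu>_def \<zeta>_def w_def power2_norm_eq_inner inner_diff inner_scaleR_left
      inner_scaleR_right inner_commute[of z m]
    by (simp add: power2_eq_square algebra_simps)
  also have "\<dots> \<le> K * (1 + K - \<mu>\<^sup>2)"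
    using le by (simp add: power2_eq_square algebra_simps)
  also have "\<dots> = S * (1 + S) * (1 - \<mu>\<^sup>2)\<^sup>2"
    by (simp add: K_def power2_eq_square algebra_simps)
  also have "S * (1 + S) = (sinh a / 2)\<^sup>2"
    unfolding S_def power_divide sinh_square_eq by (simp add: power2_eq_square field_simps)
  finally have "((1 + K) * norm (z - c))\<^sup>2 \<le> (sinh a / 2 * (1 - \<mu>\<^sup>2))\<^sup>2"
    by (simp only: power_mult_distrib)
  then have "(1 + K) * norm (z - c) \<le> sinh a / 2 * (1 - \<mu>\<^sup>2)"
    by (rule power2_le_imp_le) (use a \<mu>2 in simp)
  also have "\<dots> = tanh a * (cosh a * (1 - \<mu>\<^sup>2) / 2)"
    by (simp add: tanh_def)
  also have "\<dots> \<le> tanh a * (1 + K - \<mu>)"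
  proof (rule mult_left_mono)
    have "(1 - \<mu>\<^sup>2) / 2 \<le> 1 - \<mu>"
      using zero_le_power2[of "1 - \<mu>"] by (simp add: power2_eq_square field_simps)
    moreover have "cosh a * (1 - \<mu>\<^sup>2) / 2 = (1 - \<mu>\<^sup>2) / 2 + K"
      by (simp add: K_def S_def field_simps)
    ultimately show "cosh a * (1 - \<mu>\<^sup>2) / 2 \<le> 1 + K - \<mu>"
      by linarith
  qed (use a in simp)
  also have "\<dots> = (1 + K) * (tanh a * (1 - norm c))"
    unfolding nc using K by (simp add: field_simps)
  finally have "norm (z - c) \<le> tanh a * (1 - norm c)"
    using K by simp
  then show "z \<in> cball c (tanh a * (1 - norm c))"
    by (simp add: dist_norm norm_minus_commute)
qed

text \<open>
  The point \<open>y\<close> is at distance at most \<open>(1 + s) * (1 - norm x)\<close> from the unit sphere, which bounds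
  the denominator in the formula for \<open>hyp_dist\<close>. The comparison is strict because
  \<open>(1 + norm x) * (1 + norm y) < 4\<close>.
\<close>
lemma hyp_dist_gt_ln:
  fixes x y :: "real ^ 'n"
  assumes x: "x \<in> ball 0 1" and y: "y \<in> ball 0 1" and s: "0 < s"
    and xy: "norm (x - y) = s * (1 - norm x)"
  shows "ln (1 + s) < hyp_dist x y"
proof -
  define p q where "p = norm x" and "q = norm y"
  have p: "0 \<le> p" "p < 1" and q: "0 \<le> q" "q < 1"
    using x y by (auto simp: p_def q_def)
  have "p - q \<le> s * (1 - p)"
    using norm_triangle_ineq2[of x y] xy by (simp add: p_def q_def)
  then have 1: "1 - q \<le> (1 + s) * (1 - p)"
    by (simp add: algebra_simps)
  have 2: "(1 + p) * (1 + q) < 4"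
    using p q mult_strict_mono[of "1 + p" 2 "1 + q" 2] by simp
  have "(1 - p\<^sup>2) * (1 - q\<^sup>2) = ((1 + p) * (1 + q)) * (1 - p) * (1 - q)"
    by (simp add: power2_eq_square algebra_simps)
  also have "\<dots> < 4 * (1 - p) * (1 - q)"
    using p q 2 by (intro mult_strict_right_mono) auto
  also have "\<dots> \<le> 4 * (1 - p) * ((1 + s) * (1 - p))"
    using 1 p by (intro mult_left_mono) auto
  finally have lt: "(1 - p\<^sup>2) * (1 - q\<^sup>2) < 4 * (1 + s) * (1 - p)\<^sup>2"
    by (simp only: power2_eq_square mult_ac)
  have pos: "0 < (1 - p\<^sup>2) * (1 - q\<^sup>2)"
    using one_minus_norm_sq_pos[OF x] one_minus_norm_sq_pos[OF y] by (simp add: p_def q_def)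
  have "cosh (ln (1 + s)) = 1 + s\<^sup>2 / (2 * (1 + s))"
    using s by (simp add: cosh_ln_real field_simps power2_eq_square)
  also have "\<dots> = 1 + 2 * (s * (1 - p))\<^sup>2 / (4 * (1 + s) * (1 - p)\<^sup>2)"
    using s p by (simp add: power_mult_distrib) (simp add: field_simps)
  also have "\<dots> < 1 + 2 * (s * (1 - p))\<^sup>2 / ((1 - p\<^sup>2) * (1 - q\<^sup>2))"
    using s p by (intro add_strict_left_mono divide_strict_left_mono[OF lt _ mult_pos_pos[OF _ pos]]) auto
  also have "\<dots> = cosh (hyp_dist x y)"
    unfolding cosh_hyp_dist[OF x y] xy p_def q_def ..
  finally show ?thesis
    using s hyp_dist_nonneg[OF x y] cosh_real_nonneg_less_iff[of "ln (1 + s)" "hyp_dist x y"] by simp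
qed

section \<open>Harnack functions\<close>

lemma harnack_function_le:
  assumes u: "harnack_function G s C u" and r: "0 < r" "ball c r \<subseteq> G"
    and x: "x \<in> cball c (s * r)" and y: "y \<in> cball c (s * r)"
  shows "u x \<le> C * u y"
proof -
  have s: "0 < s" "s < 1" and C: "1 \<le> C" and cont: "continuous_on G u"
    and H: "(SUP z\<in>cball c (s * r). u z) \<le> C * (INF z\<in>cball c (s * r). u z)"
    using u r unfolding harnack_function_def by auto
  have "s * r < r"
    using s r by simp
  then have "cball c (s * r) \<subseteq> ball c r"
    by auto
  then have "continuous_on (cball c (s * r)) u"
    using cont r(2) continuous_on_subset by blast
  then have "compact (u ` cball c (s * r))"
    by (rule compact_continuous_image) simp
  then have "bounded (u ` cball c (s * r))"
    by (rule compact_imp_bounded)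
  then have "bdd_above (u ` cball c (s * r))" "bdd_below (u ` cball c (s * r))"
    by (simp_all add: bounded_imp_bdd_above bounded_imp_bdd_below)
  then have "u x \<le> (SUP z\<in>cball c (s * r). u z)" "(INF z\<in>cball c (s * r). u z) \<le> u y"
    using x y by (auto intro: cSUP_upper cINF_lower)
  with H C show ?thesis
    by (smt (verit) mult_left_mono)
qed

text \<open>
  The closed hyperbolic ball of radius \<open>artanh s\<close> about the midpoint of \<open>x\<close> and \<open>y\<close> contains
  both points, and it lies in a Euclidean ball to which the Harnack condition applies.
\<close>

lemma harnack_function_hyp_close:
  assumes u: "harnack_function (ball 0 1) s C u"
    and x: "x \<in> ball 0 1" and y: "y \<in> ball 0 1"
    and xy: "hyp_dist x y \<le> 2 * artanh s"
  shows "u x \<le> C * u y"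
proof -
  have s: "0 < s" "s < 1"
    using u by (simp_all add: harnack_function_def)
  have ge0: "0 \<le> hyp_dist x y"
    by (rule hyp_dist_nonneg[OF x y])
  obtain m where m: "m \<in> ball 0 1" "hyp_dist x m = hyp_dist x y / 2"
    "hyp_dist m y = hyp_dist x y - hyp_dist x y / 2"
    using hyp_geodesic_point[OF x y, of "hyp_dist x y / 2"] ge0 by auto
  have t: "tanh (artanh s) = s"
    using s by (simp add: tanh_real_altdef artanh_def exp_minus exp_ln field_simps)
  have a: "0 \<le> artanh s"
    using xy ge0 by simp
  obtain c where c: "c \<in> ball 0 1"
    "\<And>z. z \<in> ball 0 1 \<Longrightarrow> hyp_dist m z \<le> artanh s \<Longrightarrow> z \<in> cball c (s * (1 - norm c))"
    using hyp_ball_subset_cball[OF m(1) a] unfolding t by metis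
  have sub: "ball c (1 - norm c) \<subseteq> ball 0 1"
    by (rule ball_subset_ball_iff[THEN iffD2]) (simp add: dist_norm)
  show ?thesis
    by (rule harnack_function_le[OF u _ sub])
       (use c m x y xy hyp_dist_commute[of m x] in auto)
qed

text \<open>
  The geodesic is cut into pieces of length \<open>2 * artanh s\<close> starting at \<open>x\<close>; each piece costs one
  factor \<open>C\<close>.
\<close>

lemma harnack_function_chain:
  assumes u: "harnack_function (ball 0 1) s C u"
    and x: "x \<in> ball 0 1" and y: "y \<in> ball 0 1"
    and xy: "hyp_dist x y \<le> real (Suc k) * (2 * artanh s)"
  shows "u x \<le> C ^ Suc k * u y"
  using x xy
proof (induction k arbitrary: x)
  case 0
  then show ?case
    using harnack_function_hyp_close[OF u _ y] by simp
next
  case (Suc k)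
  have s: "0 < s" "s < 1" and C: "1 \<le> C"
    using u by (simp_all add: harnack_function_def)
  have a: "0 \<le> artanh s"
    using s by (simp add: artanh_def)
  show ?case
  proof (cases "hyp_dist x y \<le> 2 * artanh s")
    case True
    have "u x \<le> C * u y"
      by (rule harnack_function_hyp_close[OF u Suc.prems(1) y True])
    also have "\<dots> \<le> C ^ Suc (Suc k) * u y"
      using C u y self_le_power[of C "Suc (Suc k)"]
      by (intro mult_right_mono) (auto simp: harnack_function_def)
    finally show ?thesis .
  next
    case False
    then obtain z where z: "z \<in> ball 0 1" "hyp_dist x z = 2 * artanh s"
      "hyp_dist z y = hyp_dist x y - 2 * artanh s"
      using hyp_geodesic_point[OF Suc.prems(1) y, of "2 * artanh s"] a by auto
    have "u x \<le> C * u z"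
      using harnack_function_hyp_close[OF u Suc.prems(1) z(1)] z(2) by simp
    also have "u z \<le> C ^ Suc k * u y"
      using Suc.prems z by (intro Suc.IH) (auto simp: algebra_simps)
    finally show ?thesis
      using C by (simp add: mult_left_mono mult.assoc)
  qed
qed

lemma harnack_function_hyp_dist:
  assumes u: "harnack_function (ball 0 1) s C u"
    and x: "x \<in> ball 0 1" and y: "y \<in> ball 0 1"
  shows "u x \<le> C powr (1 + hyp_dist x y / (2 * artanh s)) * u y"
proof -
  have s: "0 < s" "s < 1" and C: "1 \<le> C"
    using u by (simp_all add: harnack_function_def)
  have a: "0 < artanh s"
    using s by (simp add: artanh_def)
  define t where "t = hyp_dist x y / (2 * artanh s)"
  \<comment> \<open>Rounding t down and adding 1, rather than rounding up, leaves one piece when t = 0.\<close>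
  define k where "k = nat \<lfloor>t\<rfloor>"
  have "0 \<le> t"
    using a hyp_dist_nonneg[OF x y] by (simp add: t_def)
  then have k: "real k \<le> t" "t \<le> real (Suc k)"
    unfolding k_def by linarith+
  have "hyp_dist x y \<le> real (Suc k) * (2 * artanh s)"
    using k(2) a unfolding t_def by (simp add: pos_divide_le_eq)
  then have "u x \<le> C ^ Suc k * u y"
    by (rule harnack_function_chain[OF u x y])
  also have "C ^ Suc k = C powr real (Suc k)"
    using C by (subst powr_realpow) auto
  also have "\<dots> \<le> C powr (1 + t)"
    using k(1) C by (intro powr_mono) auto
  finally show ?thesis
    using u y by (simp add: t_def mult_right_mono harnack_function_def)
qed

section \<open>Differentiation and integration\<close>

text \<open>
  Differentiation under the integral sign, with an integrable Lipschitz constant in place of a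
  bound for the derivative. The functions cut off at the unit sphere below have kinks there,
  where only the Lipschitz bound is available.
\<close>

lemma has_field_derivative_integral:
  fixes F :: "real \<Rightarrow> 'a \<Rightarrow> real"
  assumes e: "0 < e"
    and int: "\<And>t. \<bar>t\<bar> < e \<Longrightarrow> integrable M (F t)"
    and F': "F' \<in> borel_measurable M"
    and G: "integrable M G"
    and lip: "\<And>t z. \<bar>t\<bar> < e \<Longrightarrow> \<bar>F t z - F 0 z\<bar> \<le> \<bar>t\<bar> * G z"
    and der: "AE z in M. ((\<lambda>t. F t z) has_field_derivative F' z) (at 0)"
  shows "((\<lambda>t. \<integral>z. F t z \<partial>M) has_field_derivative (\<integral>z. F' z \<partial>M)) (at 0)"
  unfolding DERIV_def tendsto_at_iff_sequentially
proof (intro allI impI)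
  fix X :: "nat \<Rightarrow> real"
  assume X0: "\<forall>i. X i \<in> UNIV - {0}" and X: "X \<longlonglongrightarrow> 0"
  let ?Q = "\<lambda>h z. (F h z - F 0 z) / h"
  obtain N where N: "\<And>n. N \<le> n \<Longrightarrow> \<bar>X n\<bar> < e"
    using LIMSEQ_D[OF X e] by auto
  have "(\<lambda>i. \<integral>z. ?Q (X (i + N)) z \<partial>M) \<longlonglongrightarrow> (\<integral>z. F' z \<partial>M)"
  proof (rule integral_dominated_convergence)
    show "?Q (X (i + N)) \<in> borel_measurable M" for i
    proof -
      have [measurable]: "F (X (i + N)) \<in> borel_measurable M" "F 0 \<in> borel_measurable M"
        using int[of "X (i + N)"] int[of 0] N[of "i + N"] e by auto
      show ?thesis
        by measurable
    qed
    show "AE z in M. norm (?Q (X (i + N)) z) \<le> G z" for i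
    proof (rule AE_I2)
      fix z
      have "\<bar>F (X (i + N)) z - F 0 z\<bar> \<le> \<bar>X (i + N)\<bar> * G z"
        by (rule lip[OF N]) simp
      moreover have "X (i + N) \<noteq> 0"
        using X0 by blast
      ultimately show "norm (?Q (X (i + N)) z) \<le> G z"
        by (simp add: abs_divide pos_divide_le_eq mult.commute)
    qed
    show "AE z in M. (\<lambda>i. ?Q (X (i + N)) z) \<longlonglongrightarrow> F' z"
      using der
    proof eventually_elim
      case (elim z)
      then have "((\<lambda>h. ?Q h z) \<circ> X) \<longlonglongrightarrow> F' z"
        using X0 X unfolding DERIV_def tendsto_at_iff_sequentially by simp
      then show ?case
        by (auto dest: LIMSEQ_ignore_initial_segment[where k = N] simp: o_def)
    qed
  qed (fact F' G)+
  moreover have "(\<integral>z. ?Q (X (i + N)) z \<partial>M) =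
      ((\<integral>z. F (X (i + N)) z \<partial>M) - (\<integral>z. F 0 z \<partial>M)) / X (i + N)" for i
    unfolding integral_divide_zero
    by (subst Bochner_Integration.integral_diff[OF int int]) (use N e in simp_all)
  ultimately have "(\<lambda>i. ((\<integral>z. F (X (i + N)) z \<partial>M) - (\<integral>z. F 0 z \<partial>M)) / X (i + N)) \<longlonglongrightarrow>
      (\<integral>z. F' z \<partial>M)"
    by (simp only:)
  then have "(\<lambda>i. ((\<integral>z. F (X i) z \<partial>M) - (\<integral>z. F 0 z \<partial>M)) / X i) \<longlonglongrightarrow> (\<integral>z. F' z \<partial>M)"
    by (rule LIMSEQ_offset)
  then show "((\<lambda>h. ((\<integral>z. F (0 + h) z \<partial>M) - (\<integral>z. F 0 z \<partial>M)) / h) \<circ> X) \<longlonglongrightarrow>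
      (\<integral>z. F' z \<partial>M)"
    by (simp add: o_def)
qed

lemma
  fixes f :: "'a::euclidean_space \<Rightarrow> real"
  assumes "integrable lborel f"
  shows integrable_lborel_translate: "integrable lborel (\<lambda>z. f (c + z))"
    and integral_lborel_translate: "(\<integral>z. f (c + z) \<partial>lborel) = (\<integral>z. f z \<partial>lborel)"
proof -
  have f: "f \<in> borel_measurable borel"
    using assms by simp
  have "integrable (distr lborel borel ((+) c)) f"
    using assms by (simp add: lborel_distr_plus)
  then show "integrable lborel (\<lambda>z. f (c + z))"
    using f by (subst (asm) integrable_distr_eq) auto
  have "(\<integral>z. f z \<partial>distr lborel borel ((+) c)) = (\<integral>z. f (c + z) \<partial>lborel)"
    using f by (subst integral_distr) auto
  then show "(\<integral>z. f (c + z) \<partial>lborel) = (\<integral>z. f z \<partial>lborel)"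
    by (simp add: lborel_distr_plus)
qed

text \<open>
  This replaces the divergence theorem: translating a function does not change its integral, so
  the derivative of the integral along a translation vanishes, and that derivative is the
  integral of the directional derivative.
\<close>

lemma integral_directional_derivative_eq_0:
  fixes f f' :: "'a::euclidean_space \<Rightarrow> real"
  assumes supp: "\<And>z. z \<notin> cball 0 b \<Longrightarrow> f z = 0"
    and lip: "\<And>y z. \<bar>f y - f z\<bar> \<le> L * norm (y - z)"
    and f': "f' \<in> borel_measurable lborel"
    and der: "AE z in lborel. ((\<lambda>t. f (z + t *\<^sub>R v)) has_field_derivative f' z) (at 0)"
  shows "(\<integral>z. f' z \<partial>lborel) = 0"
proof -
  have "\<bar>f y - f z\<bar> \<le> max 1 L * norm (y - z)" for y z
    using lip[of y z] by (rule order_trans) (simp add: mult_right_mono)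
  then have "(max 1 L)-lipschitz_on UNIV f"
    by (intro lipschitz_onI) (auto simp: dist_norm)
  then have "continuous_on (cball 0 b) f"
    using lipschitz_on_continuous_on lipschitz_on_subset by blast
  then have "integrable lborel (\<lambda>z. indicator (cball 0 b) z *\<^sub>R f z)"
    by (intro borel_integrable_compact) auto
  also have "(\<lambda>z. indicator (cball 0 b) z *\<^sub>R f z) = f"
    using supp by (auto simp: indicator_def fun_eq_iff)
  finally have int: "integrable lborel f" .
  have eq: "f (z + t *\<^sub>R v) = f (t *\<^sub>R v + z)" for z t
    by (simp add: add.commute)
  define G where "G z = indicator (cball 0 (b + norm v)) z *\<^sub>R (L * norm v)" for z :: 'a
  have "((\<lambda>t. \<integral>z. f (z + t *\<^sub>R v) \<partial>lborel) has_field_derivative (\<integral>z. f' z \<partial>lborel)) (at 0)"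
  proof (rule has_field_derivative_integral[where e = 1 and G = G])
    show "integrable lborel (\<lambda>z. f (z + t *\<^sub>R v))" for t
      unfolding eq by (rule integrable_lborel_translate[OF int])
    show "integrable lborel G"
      unfolding G_def by (intro borel_integrable_compact) auto
    fix t :: real and z :: 'a
    assume t: "\<bar>t\<bar> < 1"
    show "\<bar>f (z + t *\<^sub>R v) - f (z + 0 *\<^sub>R v)\<bar> \<le> \<bar>t\<bar> * G z"
    proof (cases "z \<in> cball 0 (b + norm v)")
      case True
      then show ?thesis
        using lip[of "z + t *\<^sub>R v" z] by (simp add: G_def mult_ac)
    next
      case False
      have "norm (t *\<^sub>R v) \<le> norm v"
        using t by (simp add: mult_left_le_one_le)
      then have "z + t *\<^sub>R v \<notin> cball 0 b"
        using False norm_diff_ineq[of z "t *\<^sub>R v"] by simp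
      moreover have "z \<notin> cball 0 b"
        using False norm_ge_zero[of v] by (simp del: norm_ge_zero)
      ultimately show ?thesis
        using supp False by (simp add: G_def)
    qed
  qed (use f' der in auto)
  moreover have "(\<integral>z. f (z + t *\<^sub>R v) \<partial>lborel) = (\<integral>z. f z \<partial>lborel)" for t
    unfolding eq by (rule integral_lborel_translate[OF int])
  ultimately show ?thesis
    using DERIV_unique[OF DERIV_const] by simp
qed

lemma integral_cball_rescale:
  fixes f :: "'a::euclidean_space \<Rightarrow> real"
  assumes r: "0 < r" and f: "continuous_on (cball p r) f"
  shows "(LINT z:cball p r|lborel. f z) = r ^ DIM('a) * (LINT z:cball 0 1|lborel. f (p + r *\<^sub>R z))"
proof -
  let ?g = "\<lambda>z. indicator (cball p r) z *\<^sub>R f z"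
  have g: "?g \<in> borel_measurable borel"
    using f by (intro borel_measurable_continuous_on_indicator) auto
  have "(\<integral>z. ?g z \<partial>lborel) =
      (\<integral>z. ?g z \<partial>density (distr lborel borel (\<lambda>z. p + r *\<^sub>R z)) (\<lambda>_. ennreal (r ^ DIM('a))))"
    using r lborel_affine[of r p] by simp
  also have "\<dots> = (\<integral>z. r ^ DIM('a) *\<^sub>R ?g z \<partial>distr lborel borel (\<lambda>z. p + r *\<^sub>R z))"
    using r g by (intro integral_density) auto
  also have "\<dots> = (\<integral>z. r ^ DIM('a) *\<^sub>R ?g (p + r *\<^sub>R z) \<partial>lborel)"
    using g by (intro integral_distr) auto
  also have "\<dots> = r ^ DIM('a) * (\<integral>z. ?g (p + r *\<^sub>R z) \<partial>lborel)"
    by simp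
  also have "(\<lambda>z. ?g (p + r *\<^sub>R z)) = (\<lambda>z. indicator (cball 0 1) z *\<^sub>R f (p + r *\<^sub>R z))"
    using r by (auto simp: indicator_def dist_norm fun_eq_iff)
  finally show ?thesis
    by (simp add: set_lebesgue_integral_def)
qed

text \<open>
  The factor \<open>1 - (norm z)\<^sup>2\<close> has gradient \<open>- 2 *\<^sub>R z\<close>, a multiple of the radial direction, and
  vanishes on the unit sphere, so the product with a Lipschitz function \<open>g\<close> stays Lipschitz when
  extended by zero.
\<close>

definition paraboloid_cutoff :: "(real ^ 'n \<Rightarrow> real) \<Rightarrow> real ^ 'n \<Rightarrow> real" where
  "paraboloid_cutoff g z = (if norm z \<le> 1 then g z * (1 - (norm z)\<^sup>2) else 0)"

lemma paraboloid_cutoff_lipschitz: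
  fixes g :: "real ^ 'n \<Rightarrow> real"
  assumes L: "\<And>y z. y \<in> cball 0 1 \<Longrightarrow> z \<in> cball 0 1 \<Longrightarrow> \<bar>g y - g z\<bar> \<le> L * norm (y - z)"
    and B: "\<And>z. z \<in> cball 0 1 \<Longrightarrow> \<bar>g z\<bar> \<le> B"
  shows "\<bar>paraboloid_cutoff g y - paraboloid_cutoff g z\<bar> \<le> (L + 2 * B) * norm (y - z)"
proof -
  have B0: "0 \<le> B"
    using B[of 0] by simp
  have L0: "0 \<le> L * norm (y - z)" for y z :: "real ^ 'n"
  proof -
    obtain w :: "real ^ 'n" where "norm w = 1"
      using vector_choose_size[of 1] by auto
    then have "0 \<le> L"
      using L[of w 0] by simp
    then show ?thesis
      by simp
  qed
  have one_sided: "\<bar>paraboloid_cutoff g y - paraboloid_cutoff g z\<bar> \<le> (L + 2 * B) * norm (y - z)"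
    if yz: "norm y \<le> norm z" for y z
  proof -
    have d: "norm z - norm y \<le> norm (y - z)"
      by (metis norm_minus_commute norm_triangle_ineq2)
    consider "norm z \<le> 1" | "norm y \<le> 1" "1 < norm z" | "1 < norm y"
      using yz by linarith
    then show ?thesis
    proof cases
      case 1
      have "(norm y)\<^sup>2 \<le> 1"
        using 1 yz by (simp add: abs_square_le_1)
      then have y1: "\<bar>1 - (norm y)\<^sup>2\<bar> \<le> 1"
        by simp
      have "paraboloid_cutoff g y - paraboloid_cutoff g z =
          (g y - g z) * (1 - (norm y)\<^sup>2) + g z * ((norm z + norm y) * (norm z - norm y))"
        using 1 yz by (simp add: paraboloid_cutoff_def power2_eq_square algebra_simps)
      also have "\<bar>\<dots>\<bar> \<le> \<bar>g y - g z\<bar> * \<bar>1 - (norm y)\<^sup>2\<bar> + \<bar>g z\<bar> * ((norm z + norm y) * (norm z - norm y))"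
        using yz by (intro order_trans[OF abs_triangle_ineq]) (simp add: abs_mult)
      also have "\<dots> \<le> (L * norm (y - z)) * 1 + B * (2 * norm (y - z))"
        using 1 yz d B0 L0 y1 by (intro add_mono mult_mono L B) auto
      finally show ?thesis
        by (simp add: algebra_simps)
    next
      case 2
      have "paraboloid_cutoff g y - paraboloid_cutoff g z = g y * ((1 + norm y) * (1 - norm y))"
        using 2 by (simp add: paraboloid_cutoff_def power2_eq_square algebra_simps)
      then have "\<bar>paraboloid_cutoff g y - paraboloid_cutoff g z\<bar> = \<bar>g y\<bar> * ((1 + norm y) * (1 - norm y))"
        using 2 by (simp add: abs_mult)
      also have "\<dots> \<le> B * (2 * norm (y - z))"
        using 2 d B0 by (intro mult_mono B) auto
      also have "\<dots> \<le> (L + 2 * B) * norm (y - z)"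
        using L0[of y z] by (simp add: algebra_simps)
      finally show ?thesis .
    next
      case 3
      then show ?thesis
        using yz L0[of y z] B0 by (simp add: paraboloid_cutoff_def algebra_simps)
    qed
  qed
  show ?thesis
  proof (cases "norm y \<le> norm z")
    case False
    then show ?thesis
      using one_sided[of z y] by (simp add: norm_minus_commute abs_minus_commute)
  qed (rule one_sided)
qed

lemma paraboloid_cutoff_directional_derivative:
  fixes g :: "real ^ 'n \<Rightarrow> real"
  assumes z: "norm z \<noteq> 1"
    and g: "norm z < 1 \<Longrightarrow> ((\<lambda>t. g (z + t *\<^sub>R v)) has_field_derivative g') (at 0)"
  shows "((\<lambda>t. paraboloid_cutoff g (z + t *\<^sub>R v)) has_field_derivative
    indicator (cball 0 1) z *\<^sub>R (g' * (1 - z \<bullet> z) - 2 * g z * (z \<bullet> v))) (at 0)"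
proof -
  have lim: "((\<lambda>t. norm (z + t *\<^sub>R v)) \<longlongrightarrow> norm z) (nhds 0)"
  proof -
    have "isCont (\<lambda>t. norm (z + t *\<^sub>R v)) 0"
      by (intro continuous_intros)
    then show ?thesis
      using tendsto_at_iff_tendsto_nhds[of "\<lambda>t. norm (z + t *\<^sub>R v)" 0] by (simp add: isCont_def)
  qed
  show ?thesis
  proof (cases "norm z < 1")
    case True
    have "((\<lambda>t. g (z + t *\<^sub>R v) * (1 - (z + t *\<^sub>R v) \<bullet> (z + t *\<^sub>R v))) has_field_derivative
        g' * (1 - z \<bullet> z) - 2 * g z * (z \<bullet> v)) (at 0)"
    proof -
      have "((\<lambda>t. (z + t *\<^sub>R v) \<bullet> (z + t *\<^sub>R v)) has_field_derivative 2 * (z \<bullet> v)) (at 0)"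
      proof -
        have "(\<lambda>t. (z + t *\<^sub>R v) \<bullet> (z + t *\<^sub>R v)) = (\<lambda>t. z \<bullet> z + t * (2 * (z \<bullet> v)) + t ^ 2 * (v \<bullet> v))"
          by (simp add: fun_eq_iff inner_add inner_commute power2_eq_square algebra_simps)
        then show ?thesis
          by (auto intro!: derivative_eq_intros)
      qed
      then show ?thesis
        using g[OF True] by (auto intro!: derivative_eq_intros)
    qed
    moreover have "\<forall>\<^sub>F t in nhds 0. paraboloid_cutoff g (z + t *\<^sub>R v) =
        g (z + t *\<^sub>R v) * (1 - (z + t *\<^sub>R v) \<bullet> (z + t *\<^sub>R v))"
      using order_tendstoD(2)[OF lim True]
      by eventually_elim (simp add: paraboloid_cutoff_def power2_norm_eq_inner)
    ultimately show ?thesis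
      using True by (subst DERIV_cong_ev[OF refl _ refl]) auto
  next
    case False
    then have "1 < norm z"
      using z by simp
    then have "\<forall>\<^sub>F t in nhds 0. paraboloid_cutoff g (z + t *\<^sub>R v) = 0"
      by (rule eventually_mono[OF order_tendstoD(1)[OF lim]]) (simp add: paraboloid_cutoff_def)
    then show ?thesis
      using False z by (subst DERIV_cong_ev[OF refl _ refl]) auto
  qed
qed

lemma AE_norm_neq: "AE z :: 'a::euclidean_space in lborel. norm z \<noteq> 1"
proof -
  have "sphere (0::'a) 1 \<in> null_sets lborel"
    using negligible_sphere[of "0::'a" 1]
    by (auto simp: null_sets_completion_iff negligible_iff_null_sets)
  then show ?thesis
    by (rule AE_I') auto
qed

section \<open>Mean value property of harmonic functions\<close>

text \<open>
  The Laplacian is defined through iterated one-dimensional derivatives along the axes; for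
  twice differentiable functions it is the trace of the second Frechet derivative.
\<close>

lemma harmonic_function_onE:
  fixes u :: "real ^ 'n \<Rightarrow> real"
  assumes "harmonic_function_on G u"
  obtains D :: "real ^ 'n \<Rightarrow> (real ^ 'n) \<Rightarrow>\<^sub>L real"
    and H :: "real ^ 'n \<Rightarrow> (real ^ 'n) \<Rightarrow>\<^sub>L (real ^ 'n) \<Rightarrow>\<^sub>L real"
  where "open G" "\<And>x. x \<in> G \<Longrightarrow> (u has_derivative D x) (at x)"
    "\<And>x. x \<in> G \<Longrightarrow> (D has_derivative H x) (at x)" "continuous_on G H"
    "\<And>x. x \<in> G \<Longrightarrow> (\<Sum>i\<in>UNIV. H x (axis i 1) (axis i 1)) = 0"
proof -
  obtain D H where D: "\<And>x. x \<in> G \<Longrightarrow> (u has_derivative blinfun_apply (D x)) (at x)"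
    and H: "\<And>x. x \<in> G \<Longrightarrow> (D has_derivative blinfun_apply (H x)) (at x)" "continuous_on G H"
    and G: "open G" "\<And>x. x \<in> G \<Longrightarrow> laplacian u x = 0"
    using assms unfolding harmonic_function_on_def twice_cont_diff_on_def by blast
  have line: "((\<lambda>t. x + t *\<^sub>R v) has_derivative (\<lambda>t. t *\<^sub>R v)) (at 0)" for x v :: "real ^ 'n"
    by (auto intro!: derivative_eq_intros)
  have along: "((\<lambda>t. f (x + t *\<^sub>R v)) has_field_derivative f' v) (at 0)"
    if "(f has_derivative f') (at x)" for f f' and x v :: "real ^ 'n"
  proof -
    have "((\<lambda>t. f (x + t *\<^sub>R v)) has_derivative (\<lambda>t. f' (t *\<^sub>R v))) (at 0)"
      using has_derivative_compose[OF line, of f f' x v] that by simp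
    then show ?thesis
      by (rule has_derivative_imp_has_field_derivative)
        (simp add: linear_scale[OF has_derivative_linear[OF that]])
  qed
  have pd: "partial_derivative i u x = D x (axis i 1)" if "x \<in> G" for i x
    unfolding partial_derivative_def by (intro DERIV_imp_deriv along D that)
  have "partial_derivative i (partial_derivative i u) x = H x (axis i 1) (axis i 1)" if x: "x \<in> G" for i x
    unfolding partial_derivative_def[of i "partial_derivative i u"]
  proof (intro DERIV_imp_deriv along[of _ "\<lambda>v. H x v (axis i 1)"])
    have "((\<lambda>y. D y (axis i 1)) has_derivative (\<lambda>v. H x v (axis i 1))) (at x)"
      using H(1)[OF x] by (auto intro!: derivative_eq_intros simp: blinfun.bilinear_simps)
    then show "(partial_derivative i u has_derivative (\<lambda>v. H x v (axis i 1))) (at x)"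
      by (rule has_derivative_transform_within_open[OF _ G(1) x]) (simp add: pd)
  qed
  then have "(\<Sum>i\<in>UNIV. H x (axis i 1) (axis i 1)) = 0" if "x \<in> G" for x
    using G(2)[OF that] that by (simp add: laplacian_def)
  then show ?thesis
    using that[OF G(1) D H] by blast
qed

lemma harmonic_continuous_on:
  assumes "harmonic_function_on G u"
  shows "continuous_on G u"
  using assms unfolding harmonic_function_on_def twice_cont_diff_on_def
  by (meson continuous_at_imp_continuous_on has_derivative_continuous)

lemma line_in_ball:
  fixes x z :: "'a::real_normed_vector"
  assumes "z \<in> cball 0 1" "\<bar>r\<bar> \<le> r'"
  shows "x + r *\<^sub>R z \<in> cball x r'"
proof -
  have "\<bar>r\<bar> * norm z \<le> r' * 1"
    using assms by (intro mult_mono) auto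
  then show ?thesis
    by (simp add: dist_norm)
qed

text \<open>
  Put \<open>w z = 1 - (norm z)\<^sup>2\<close>, cut off outside the unit ball. For each \<open>i\<close> the integral of the
  \<open>i\<close>-th partial derivative in \<open>z\<close> of \<open>D (x + r *\<^sub>R z) (axis i 1) * w z\<close> is zero. Summed over \<open>i\<close>,
  the terms in which \<open>D\<close> is differentiated add up to \<open>r\<close> times the Laplacian times \<open>w\<close>, which is
  zero, and those in which \<open>w\<close> is differentiated to \<open>- 2 * D (x + r *\<^sub>R z) z\<close>. Taking a quadratic
  \<open>w\<close> is what makes the resulting radial derivative unweighted.
\<close>

lemma integral_radial_derivative_eq_0:
  fixes u :: "real ^ 'n \<Rightarrow> real"
    and D :: "real ^ 'n \<Rightarrow> (real ^ 'n) \<Rightarrow>\<^sub>L real"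
    and H :: "real ^ 'n \<Rightarrow> (real ^ 'n) \<Rightarrow>\<^sub>L (real ^ 'n) \<Rightarrow>\<^sub>L real"
  assumes D: "\<And>x. x \<in> G \<Longrightarrow> (D has_derivative H x) (at x)" and H: "continuous_on G H"
    and trace: "\<And>x. x \<in> G \<Longrightarrow> (\<Sum>i\<in>UNIV. H x (axis i 1) (axis i 1)) = 0"
    and sub: "cball x \<bar>r\<bar> \<subseteq> G"
  shows "(\<integral>z. indicator (cball 0 1) z *\<^sub>R D (x + r *\<^sub>R z) z \<partial>lborel) = 0"
proof -
  have in_G: "x + r *\<^sub>R z \<in> G" if "z \<in> cball 0 1" for z
    using line_in_ball[OF that order_refl] sub by blast
  have contD: "continuous_on G D"
    using D has_derivative_continuous by (blast intro: continuous_at_imp_continuous_on)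
  have cont_line: "continuous_on (cball 0 1) (\<lambda>z. x + r *\<^sub>R z)"
    by (intro continuous_intros)
  have cD: "continuous_on (cball 0 1) (\<lambda>z. D (x + r *\<^sub>R z))"
    and cH: "continuous_on (cball 0 1) (\<lambda>z. H (x + r *\<^sub>R z))"
    using in_G by (auto intro!: continuous_on_compose2[OF contD cont_line]
        continuous_on_compose2[OF H cont_line])
  define g where "g i z = D (x + r *\<^sub>R z) (axis i 1)" for i z
  define f' where "f' i z = indicator (cball 0 1) z *\<^sub>R
    (r * H (x + r *\<^sub>R z) (axis i 1) (axis i 1) * (1 - z \<bullet> z) - 2 * g i z * (z \<bullet> axis i 1))" for i z
  have der_g: "(g i has_derivative (\<lambda>v. r * H (x + r *\<^sub>R z) v (axis i 1))) (at z)"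
    if "z \<in> cball 0 1" for i z
  proof -
    have "((\<lambda>z. x + r *\<^sub>R z) has_derivative (\<lambda>v. r *\<^sub>R v)) (at z)"
      by (auto intro!: derivative_eq_intros)
    then have "((\<lambda>z. D (x + r *\<^sub>R z)) has_derivative (\<lambda>v. H (x + r *\<^sub>R z) (r *\<^sub>R v))) (at z)"
      using has_derivative_compose D[OF in_G[OF that]] by fastforce
    then show ?thesis
      unfolding g_def by (auto intro!: derivative_eq_intros simp: blinfun.bilinear_simps)
  qed
  have int: "integrable lborel (f' i)" for i
    unfolding f'_def g_def by (intro borel_integrable_compact continuous_intros cD cH) auto
  have zero: "(\<integral>z. f' i z \<partial>lborel) = 0" for i
  proof -
    have "compact ((\<lambda>z. H (x + r *\<^sub>R z)) ` cball 0 1)"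
      by (intro compact_continuous_image cH) auto
    then obtain B1 where B1: "\<And>z. z \<in> cball 0 1 \<Longrightarrow> norm (H (x + r *\<^sub>R z)) \<le> B1"
      using compact_imp_bounded bounded_iff by (metis (no_types, lifting) imageI)
    have "compact ((\<lambda>z. g i z) ` cball 0 1)"
      unfolding g_def by (intro compact_continuous_image continuous_intros cD) auto
    then obtain B2 where B2: "\<And>z. z \<in> cball 0 1 \<Longrightarrow> \<bar>g i z\<bar> \<le> B2"
      using compact_imp_bounded bounded_iff by (metis (no_types, lifting) imageI real_norm_def)
    have "norm (g i y - g i z) \<le> (\<bar>r\<bar> * B1) * norm (y - z)"
      if "y \<in> cball 0 1" "z \<in> cball 0 1" for y z
    proof (rule differentiable_bound[of "cball 0 1" "g i" "\<lambda>z v. r * H (x + r *\<^sub>R z) v (axis i 1)"])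
      fix z :: "real ^ 'n"
      assume z: "z \<in> cball 0 1"
      show "(g i has_derivative (\<lambda>v. r * H (x + r *\<^sub>R z) v (axis i 1))) (at z within cball 0 1)"
        by (rule has_derivative_at_withinI[OF der_g[OF z]])
      show "onorm (\<lambda>v. r * H (x + r *\<^sub>R z) v (axis i 1)) \<le> \<bar>r\<bar> * B1"
      proof (rule onorm_le)
        fix v
        have "norm (H (x + r *\<^sub>R z) v (axis i 1)) \<le> norm (H (x + r *\<^sub>R z) v)"
          using norm_blinfun[of "H (x + r *\<^sub>R z) v" "axis i 1"] by simp
        also have "\<dots> \<le> norm (H (x + r *\<^sub>R z)) * norm v"
          by (rule norm_blinfun)
        also have "\<dots> \<le> B1 * norm v"
          by (intro mult_right_mono B1 z) auto
        finally show "norm (r * H (x + r *\<^sub>R z) v (axis i 1)) \<le> \<bar>r\<bar> * B1 * norm v"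
          by (simp add: abs_mult mult_left_mono mult.assoc)
      qed
    qed (use that in auto)
    then have lip: "\<bar>g i y - g i z\<bar> \<le> (\<bar>r\<bar> * B1) * norm (y - z)"
      if "y \<in> cball 0 1" "z \<in> cball 0 1" for y z
      using that by simp
    show ?thesis
    proof (rule integral_directional_derivative_eq_0[where f = "paraboloid_cutoff (g i)" and b = 1 and v = "axis i 1"])
      show "paraboloid_cutoff (g i) z = 0" if "z \<notin> cball 0 1" for z
        using that by (simp add: paraboloid_cutoff_def)
      show "\<bar>paraboloid_cutoff (g i) y - paraboloid_cutoff (g i) z\<bar> \<le> (\<bar>r\<bar> * B1 + 2 * B2) * norm (y - z)" for y z
        by (rule paraboloid_cutoff_lipschitz[OF lip B2])
      show "f' i \<in> borel_measurable lborel"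
        using int by blast
      show "AE z in lborel.
        ((\<lambda>t. paraboloid_cutoff (g i) (z + t *\<^sub>R axis i 1)) has_field_derivative f' i z) (at 0)"
        using AE_norm_neq
      proof eventually_elim
        case (elim z)
        show ?case
          unfolding f'_def
        proof (rule paraboloid_cutoff_directional_derivative[OF elim])
          assume z: "norm z < 1"
          have "((\<lambda>t. z + t *\<^sub>R axis i 1) has_derivative (\<lambda>t. t *\<^sub>R axis i 1)) (at 0)"
            by (auto intro!: derivative_eq_intros)
          moreover have "(g i has_derivative (\<lambda>v. r * H (x + r *\<^sub>R z) v (axis i 1))) (at (z + 0 *\<^sub>R axis i 1))"
            using der_g[of z i] z by simp
          ultimately have "((\<lambda>t. g i (z + t *\<^sub>R axis i 1)) has_derivative
              (\<lambda>t. r * H (x + r *\<^sub>R z) (t *\<^sub>R axis i 1) (axis i 1))) (at 0)"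
            by (rule has_derivative_compose)
          then show "((\<lambda>t. g i (z + t *\<^sub>R axis i 1)) has_field_derivative
              r * H (x + r *\<^sub>R z) (axis i 1) (axis i 1)) (at 0)"
            by (rule has_derivative_imp_has_field_derivative) (simp add: blinfun.bilinear_simps mult_ac)
        qed
      qed
    qed
  qed
  have "(\<Sum>i\<in>UNIV. f' i z) = - 2 * (indicator (cball 0 1) z *\<^sub>R D (x + r *\<^sub>R z) z)" for z
  proof (cases "z \<in> cball 0 1")
    case True
    have "D (x + r *\<^sub>R z) z = D (x + r *\<^sub>R z) (\<Sum>i\<in>UNIV. (z $ i) *\<^sub>R axis i 1)"
      by (simp add: basis_expansion flip: scalar_mult_eq_scaleR)
    also have "\<dots> = (\<Sum>i\<in>UNIV. g i z * (z \<bullet> axis i 1))"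
      by (simp add: blinfun.bilinear_simps g_def inner_axis mult.commute)
    finally have D_eq: "D (x + r *\<^sub>R z) z = (\<Sum>i\<in>UNIV. g i z * (z \<bullet> axis i 1))" .
    have "(\<Sum>i\<in>UNIV. f' i z) = r * (1 - z \<bullet> z) * (\<Sum>i\<in>UNIV. H (x + r *\<^sub>R z) (axis i 1) (axis i 1))
        - 2 * (\<Sum>i\<in>UNIV. g i z * (z \<bullet> axis i 1))"
      using True by (simp add: f'_def sum_subtractf sum_distrib_left mult_ac)
    then show ?thesis
      using True trace[OF in_G[OF True]] D_eq by simp
  qed (simp add: f'_def)
  moreover have "(\<integral>z. (\<Sum>i\<in>UNIV. f' i z) \<partial>lborel) = 0"
    using int zero by simp
  ultimately show ?thesis
    by simp
qed

text \<open>
  The derivative in \<open>r\<close> of the left-hand side is the integral of the radial derivative, which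
  vanishes, so the value is the one at \<open>r = 0\<close>.
\<close>

lemma harmonic_mean_unit_ball:
  fixes u :: "real ^ 'n \<Rightarrow> real"
  assumes u: "harmonic_function_on G u" and sub: "ball x R \<subseteq> G" and r: "0 \<le> r" "r < R"
  shows "(LINT z:cball 0 1|lborel. u (x + r *\<^sub>R z)) = measure lborel (cball (0 :: real ^ 'n) 1) * u x"
proof -
  obtain D :: "real ^ 'n \<Rightarrow> (real ^ 'n) \<Rightarrow>\<^sub>L real"
    and H :: "real ^ 'n \<Rightarrow> (real ^ 'n) \<Rightarrow>\<^sub>L (real ^ 'n) \<Rightarrow>\<^sub>L real"
  where G: "open G" and D: "\<And>x. x \<in> G \<Longrightarrow> (u has_derivative D x) (at x)"
    and H: "\<And>x. x \<in> G \<Longrightarrow> (D has_derivative H x) (at x)" "continuous_on G H"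
    and trace: "\<And>x. x \<in> G \<Longrightarrow> (\<Sum>i\<in>UNIV. H x (axis i 1) (axis i 1)) = 0"
    using u by (rule harmonic_function_onE) blast
  have contD: "continuous_on G D"
    using H(1) has_derivative_continuous by (blast intro: continuous_at_imp_continuous_on)
  have contu: "continuous_on G u"
    by (rule harmonic_continuous_on[OF u])
  \<comment> \<open>Negative radii make sense too, so 0 is an interior point of the interval of constancy.\<close>
  define A where "A \<rho> = (\<integral>z. indicator (cball 0 1) z *\<^sub>R u (x + \<rho> *\<^sub>R z) \<partial>lborel)" for \<rho>
  have "(A has_field_derivative 0) (at \<rho>)" if \<rho>: "\<bar>\<rho>\<bar> < R" for \<rho>
  proof -
    define e where "e = (R - \<bar>\<rho>\<bar>) / 2"
    define K where "K = cball x (\<bar>\<rho>\<bar> + e)"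
    have e: "0 < e" "\<bar>\<rho>\<bar> + e < R"
      using \<rho> by (simp_all add: e_def field_simps)
    then have KG: "K \<subseteq> G"
      using sub unfolding K_def by (auto simp: subset_iff)
    have in_K: "x + (\<rho> + t) *\<^sub>R z \<in> K" if "z \<in> cball 0 1" "\<bar>t\<bar> < e" for z t
      unfolding K_def using that by (intro line_in_ball) auto
    have "compact (D ` K)"
      using contD KG by (intro compact_continuous_image) (auto simp: K_def intro: continuous_on_subset)
    then obtain B where B: "\<And>y. y \<in> K \<Longrightarrow> norm (D y) \<le> B"
      using compact_imp_bounded bounded_iff by (metis (no_types, lifting) imageI)
    have cont_line: "continuous_on (cball 0 1) (\<lambda>z. u (x + (\<rho> + t) *\<^sub>R z))" if "\<bar>t\<bar> < e" for t
      using in_K[OF _ that] KG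
      by (intro continuous_on_compose2[OF contu] continuous_intros) auto
    have "((\<lambda>t. A (\<rho> + t)) has_field_derivative
        (\<integral>z. indicator (cball 0 1) z *\<^sub>R D (x + \<rho> *\<^sub>R z) z \<partial>lborel)) (at 0)"
      unfolding A_def
    proof (rule has_field_derivative_integral[OF e(1), where G = "\<lambda>z. indicator (cball 0 1) z *\<^sub>R B"])
      fix t :: real
      assume t: "\<bar>t\<bar> < e"
      show "integrable lborel (\<lambda>z. indicator (cball 0 1) z *\<^sub>R u (x + (\<rho> + t) *\<^sub>R z))"
        by (intro borel_integrable_compact cont_line t) auto
      fix z :: "real ^ 'n"
      show "\<bar>indicator (cball 0 1) z *\<^sub>R u (x + (\<rho> + t) *\<^sub>R z) -
          indicator (cball 0 1) z *\<^sub>R u (x + (\<rho> + 0) *\<^sub>R z)\<bar> \<le> \<bar>t\<bar> * (indicator (cball 0 1) z *\<^sub>R B)"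
      proof (cases "z \<in> cball 0 1")
        case True
        have "norm (u (x + (\<rho> + t) *\<^sub>R z) - u (x + (\<rho> + 0) *\<^sub>R z)) \<le>
            B * norm (x + (\<rho> + t) *\<^sub>R z - (x + (\<rho> + 0) *\<^sub>R z))"
        proof (rule differentiable_bound[of K])
          show "convex K"
            by (simp add: K_def)
          show "(u has_derivative D y) (at y within K)" if "y \<in> K" for y
            using that KG by (intro has_derivative_at_withinI[OF D]) blast
          show "onorm (D y) \<le> B" if "y \<in> K" for y
            by (intro onorm_le order_trans[OF norm_blinfun] mult_right_mono B that norm_ge_zero)
          show "x + (\<rho> + t) *\<^sub>R z \<in> K" "x + (\<rho> + 0) *\<^sub>R z \<in> K"
            using e by (auto intro!: in_K[OF True] t simp del: add_0_right)
        qed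
        also have "x + (\<rho> + t) *\<^sub>R z - (x + (\<rho> + 0) *\<^sub>R z) = t *\<^sub>R z"
          by (simp add: algebra_simps)
        also have "B * norm (t *\<^sub>R z) \<le> \<bar>t\<bar> * B"
        proof -
          have "0 \<le> B"
            using B[of x] e by (auto simp: K_def intro: order_trans[OF norm_ge_zero])
          then show ?thesis
            using True mult_left_mono[of "norm z" 1 "\<bar>t\<bar> * B"] by (simp add: mult_ac)
        qed
        finally show ?thesis
          using True by simp
      qed simp
    next
      have "continuous_on (cball 0 1) (\<lambda>z. D (x + \<rho> *\<^sub>R z))"
        using in_K[of _ 0] e KG by (intro continuous_on_compose2[OF contD] continuous_intros) auto
      then have "integrable lborel (\<lambda>z. indicator (cball 0 1) z *\<^sub>R D (x + \<rho> *\<^sub>R z) z)"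
        by (intro borel_integrable_compact continuous_intros) auto
      then show "(\<lambda>z. indicator (cball 0 1) z *\<^sub>R D (x + \<rho> *\<^sub>R z) z) \<in> borel_measurable lborel"
        by blast
    next
      show "AE z in lborel. ((\<lambda>t. indicator (cball 0 1) z *\<^sub>R u (x + (\<rho> + t) *\<^sub>R z)) has_field_derivative
          indicator (cball 0 1) z *\<^sub>R D (x + \<rho> *\<^sub>R z) z) (at 0)"
      proof (intro AE_I2)
        fix z :: "real ^ 'n"
        show "((\<lambda>t. indicator (cball 0 1) z *\<^sub>R u (x + (\<rho> + t) *\<^sub>R z)) has_field_derivative
          indicator (cball 0 1) z *\<^sub>R D (x + \<rho> *\<^sub>R z) z) (at 0)"
        proof (cases "z \<in> cball 0 1")
          case True
          have "((\<lambda>t. x + (\<rho> + t) *\<^sub>R z) has_derivative (\<lambda>t. t *\<^sub>R z)) (at 0)"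
            by (auto intro!: derivative_eq_intros)
          moreover have "(u has_derivative D (x + \<rho> *\<^sub>R z)) (at (x + (\<rho> + 0) *\<^sub>R z))"
            using D in_K[OF True, of 0] e KG by auto
          ultimately have "((\<lambda>t. u (x + (\<rho> + t) *\<^sub>R z)) has_derivative
              (\<lambda>t. D (x + \<rho> *\<^sub>R z) (t *\<^sub>R z))) (at 0)"
            by (rule has_derivative_compose)
          then have "((\<lambda>t. u (x + (\<rho> + t) *\<^sub>R z)) has_field_derivative D (x + \<rho> *\<^sub>R z) z) (at 0)"
            by (rule has_derivative_imp_has_field_derivative)
              (simp add: blinfun.bilinear_simps mult_ac)
          then show ?thesis
            using True by simp
        qed simp
      qed
    next
      show "integrable lborel (\<lambda>z :: real ^ 'n. indicator (cball 0 1) z *\<^sub>R B)"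
        by (intro borel_integrable_compact) auto
    qed
    also have "(\<integral>z. indicator (cball 0 1) z *\<^sub>R D (x + \<rho> *\<^sub>R z) z \<partial>lborel) = 0"
      by (rule integral_radial_derivative_eq_0[OF H trace])
        (use sub \<rho> in \<open>auto simp: subset_iff\<close>)
    finally show ?thesis
      using DERIV_shift[of A 0 0 \<rho>] by (simp add: add.commute)
  qed
  then have "\<exists>c. \<forall>\<rho>\<in>{- R<..<R}. A \<rho> = c"
    by (intro has_field_derivative_zero_constant) (auto intro: has_field_derivative_at_within)
  then have "A r = A 0"
    using r by force
  also have "A 0 = measure lborel (cball (0 :: real ^ 'n) 1) * u x"
    by (simp add: A_def)
  finally show ?thesis
    by (simp add: A_def set_lebesgue_integral_def)
qed

lemma harmonic_mean_value:
  fixes u :: "real ^ 'n \<Rightarrow> real"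
  assumes u: "harmonic_function_on G u" and sub: "ball x R \<subseteq> G" and r: "0 < r" "r < R"
  shows "(LINT z:cball x r|lborel. u z) = measure lborel (cball x r) * u x"
proof -
  have "continuous_on (cball x r) u"
    using sub r by (intro continuous_on_subset[OF harmonic_continuous_on[OF u]]) (auto simp: subset_iff)
  then have "(LINT z:cball x r|lborel. u z) =
      r ^ CARD('n) * (measure lborel (cball (0 :: real ^ 'n) 1) * u x)"
    using r harmonic_mean_unit_ball[OF u sub, of r] by (simp add: integral_cball_rescale)
  then show ?thesis
    using r by (simp add: content_cball)
qed

section \<open>Harnack inequality for positive harmonic functions\<close>

text \<open>
  For nonnegative \<open>u\<close> the integral over the ball about \<open>p\<close> is at most that over the larger ball
  about \<open>q\<close> in which it is contained; both integrals are given by the mean value property.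
\<close>

lemma harmonic_ball_comparison:
  fixes u :: "real ^ 'n \<Rightarrow> real"
  assumes u: "harmonic_function_on G u" and pos: "\<And>z. z \<in> G \<Longrightarrow> 0 \<le> u z"
    and sub: "ball q R \<subseteq> G" and r: "dist p q < r" "r < R"
  shows "(r - dist p q) ^ CARD('n) * u p \<le> r ^ CARD('n) * u q"
proof -
  define d where "d = dist p q"
  have d: "0 \<le> d" "d < r"
    using r by (simp_all add: d_def)
  have qG: "cball q r \<subseteq> G"
    using sub r by (auto simp: subset_iff)
  then have cont: "continuous_on (cball q r) u"
    by (rule continuous_on_subset[OF harmonic_continuous_on[OF u]])
  have pq: "cball p (r - d) \<subseteq> cball q r"
    unfolding d_def by (auto simp: subset_iff) (smt (verit) dist_commute dist_triangle)
  have pG: "ball p (R - d) \<subseteq> G"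
  proof -
    have "ball p (R - d) \<subseteq> ball q R"
      unfolding d_def by (auto simp: subset_iff) (smt (verit) dist_commute dist_triangle)
    then show ?thesis
      using sub by blast
  qed
  have intq: "set_integrable lborel (cball q r) u"
    unfolding set_integrable_def using cont by (intro borel_integrable_compact) auto
  then have intp: "set_integrable lborel (cball p (r - d)) u"
    by (rule set_integrable_subset[OF _ _ pq]) simp
  have "(LINT z:cball p (r - d)|lborel. u z) \<le> (LINT z:cball q r|lborel. u z)"
    using intp intq pq qG pos unfolding set_lebesgue_integral_def set_integrable_def
    by (intro integral_mono) (auto simp: indicator_def subset_iff)
  also have "(LINT z:cball p (r - d)|lborel. u z) = measure lborel (cball p (r - d)) * u p"
    using d r by (intro harmonic_mean_value[OF u pG]) auto
  also have "(LINT z:cball q r|lborel. u z) = measure lborel (cball q r) * u q"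
    using d r by (intro harmonic_mean_value[OF u sub]) auto
  finally show ?thesis
    using d by (simp add: content_cball d_def mult.assoc)
qed

text \<open>
  Comparing \<open>x + j *\<^sub>R v\<close> with \<open>x + (j + 1) *\<^sub>R v\<close> for \<open>j < k\<close> gives quotients of consecutive radii
  whose product telescopes. The ball about \<open>x + (j + 1) *\<^sub>R v\<close> could have any radius less than
  \<open>R - (j + 1) * \<delta>\<close>; the choice \<open>R - (j + 2) * \<delta>\<close> leaves the radius \<open>R - (j + 3) * \<delta>\<close> for the
  ball about \<open>x + j *\<^sub>R v\<close>.
\<close>

lemma harmonic_chain:
  fixes u :: "real ^ 'n \<Rightarrow> real"
  assumes u: "harmonic_function_on G u" and pos: "\<And>z. z \<in> G \<Longrightarrow> 0 \<le> u z"
    and sub: "ball x R \<subseteq> G" and \<delta>: "0 < \<delta>"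
    and v: "norm v = \<delta>" and k: "(real k + 2) * \<delta> < R"
  shows "(R - (real k + 2) * \<delta>) ^ CARD('n) * u x \<le> (R - 2 * \<delta>) ^ CARD('n) * u (x + real k *\<^sub>R v)"
  using k
proof (induction k)
  case (Suc k)
  let ?n = "CARD('n)"
  define d where "d j = R - j * \<delta>" for j
  define p q where "p = x + real k *\<^sub>R v" and "q = x + real (Suc k) *\<^sub>R v"
  have pq: "dist p q = \<delta>"
    using v by (simp add: p_def q_def dist_norm algebra_simps)
  have d: "0 < d (real k + 3)"
    using Suc.prems by (simp add: d_def algebra_simps)
  have d2: "0 < d (real k + 2)"
    using d \<delta> by (simp add: d_def algebra_simps)
  have IH: "d (real k + 2) ^ ?n * u x \<le> d 2 ^ ?n * u p"
    using Suc d2 unfolding d_def p_def by simp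
  have "ball q (d (real k + 1)) \<subseteq> ball x R"
  proof -
    have "dist q x = (real k + 1) * \<delta>"
      using v by (simp add: q_def dist_norm)
    then show ?thesis
      by (auto simp: subset_iff d_def) (smt (verit) dist_commute dist_triangle)
  qed
  then have "ball q (d (real k + 1)) \<subseteq> G"
    using sub by blast
  from harmonic_ball_comparison[OF u pos this, of p "d (real k + 2)"]
  have step: "d (real k + 3) ^ ?n * u p \<le> d (real k + 2) ^ ?n * u q"
    unfolding pq using d \<delta> by (simp add: d_def algebra_simps)
  have "d (real k + 2) ^ ?n * (d (real k + 3) ^ ?n * u x) =
      d (real k + 3) ^ ?n * (d (real k + 2) ^ ?n * u x)"
    by simp
  also have "\<dots> \<le> d (real k + 3) ^ ?n * (d 2 ^ ?n * u p)"
    using IH d by (intro mult_left_mono) auto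
  also have "\<dots> = d 2 ^ ?n * (d (real k + 3) ^ ?n * u p)"
    by simp
  also have "\<dots> \<le> d 2 ^ ?n * (d (real k + 2) ^ ?n * u q)"
  proof -
    have "d (real k + 2) \<le> d 2"
      using \<delta> by (simp add: d_def)
    then show ?thesis
      using step d2 by (intro mult_left_mono) auto
  qed
  also have "\<dots> = d (real k + 2) ^ ?n * (d 2 ^ ?n * u q)"
    by simp
  finally have "d (real k + 3) ^ ?n * u x \<le> d 2 ^ ?n * u q"
    using d2 by simp
  then show ?case
    by (simp add: d_def q_def add.commute add.left_commute)
qed simp

text \<open>
  Cutting the segment from \<open>x\<close> to \<open>y\<close> into \<open>N + 1\<close> equal steps and letting \<open>N\<close> tend to infinity turns
  the telescoped quotient into \<open>(1 - s) ^ CARD('n)\<close>. This amounts to integrating the gradient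
  estimate \<open>norm (\<nabla> u) \<le> CARD('n) * u / d\<close>, where \<open>d\<close> is the distance to the sphere of
  radius \<open>R\<close> about \<open>x\<close>.
\<close>

lemma harmonic_harnack:
  fixes u :: "real ^ 'n \<Rightarrow> real"
  assumes u: "harmonic_function_on G u" and pos: "\<And>z. z \<in> G \<Longrightarrow> 0 \<le> u z"
    and sub: "ball x R \<subseteq> G" and R: "0 < R" and s: "0 < s" "s < 1" and y: "dist x y = s * R"
  shows "(1 - s) ^ CARD('n) * u x \<le> u y"
proof -
  let ?n = "CARD('n)"
  have lim: "(\<lambda>N. c * inverse (real (Suc N))) \<longlonglongrightarrow> c * 0" for c
    by (intro tendsto_intros LIMSEQ_inverse_real_of_nat)
  have "(\<lambda>N. (R - s * R - 2 * s * R * inverse (real (Suc N))) ^ ?n * u x) \<longlonglongrightarrow>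
      (R - s * R - 2 * s * R * 0) ^ ?n * u x"
    by (intro tendsto_intros lim)
  moreover have "(\<lambda>N. (R - 2 * s * R * inverse (real (Suc N))) ^ ?n * u y) \<longlonglongrightarrow>
      (R - 2 * s * R * 0) ^ ?n * u y"
    by (intro tendsto_intros lim)
  moreover have "\<forall>\<^sub>F N in sequentially. (R - s * R - 2 * s * R * inverse (real (Suc N))) ^ ?n * u x \<le>
      (R - 2 * s * R * inverse (real (Suc N))) ^ ?n * u y"
  proof -
    have "\<forall>\<^sub>F N in sequentially. 2 * s * R * inverse (real (Suc N)) < R - s * R"
      using lim[of "2 * s * R"] by (rule order_tendstoD) (use s R in simp)
    then show ?thesis
    proof eventually_elim
      case (elim N)
      define \<delta> where "\<delta> = s * R * inverse (real (Suc N))"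
      define v where "v = inverse (real (Suc N)) *\<^sub>R (y - x)"
      have N\<delta>: "real (Suc N) * \<delta> = s * R"
        unfolding \<delta>_def by simp
      have Nv: "x + real (Suc N) *\<^sub>R v = y"
        unfolding v_def by simp
      have nv: "norm v = \<delta>"
        using y by (simp add: v_def \<delta>_def dist_norm norm_minus_commute)
      have "(R - (real (Suc N) + 2) * \<delta>) ^ ?n * u x \<le>
          (R - 2 * \<delta>) ^ ?n * u (x + real (Suc N) *\<^sub>R v)"
      proof (rule harmonic_chain[OF u pos sub _ nv])
        show "0 < \<delta>"
          using s R by (simp add: \<delta>_def)
        show "(real (Suc N) + 2) * \<delta> < R"
        proof -
          have "2 * \<delta> < R - s * R"
            using elim by (simp only: \<delta>_def mult.assoc)
          then show ?thesis
            using N\<delta> by (simp only: distrib_right)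
        qed
      qed
      moreover have "R - (real (Suc N) + 2) * \<delta> = R - s * R - 2 * s * R * inverse (real (Suc N))"
        unfolding distrib_right N\<delta> \<delta>_def by (simp del: of_nat_Suc)
      moreover have "R - 2 * \<delta> = R - 2 * s * R * inverse (real (Suc N))"
        unfolding \<delta>_def by (simp del: of_nat_Suc)
      ultimately show ?case
        unfolding Nv by (simp only:)
    qed
  qed
  ultimately have "(R - s * R - 2 * s * R * 0) ^ ?n * u x \<le> (R - 2 * s * R * 0) ^ ?n * u y"
    by (intro tendsto_le[OF trivial_limit_sequentially])
  moreover have "R - s * R - 2 * s * R * 0 = R * (1 - s)"
    by (simp add: algebra_simps)
  ultimately have "R ^ ?n * ((1 - s) ^ ?n * u x) \<le> R ^ ?n * u y"
    by (simp add: power_mult_distrib mult.assoc)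
  then show ?thesis
    using R by simp
qed

section \<open>Both inequalities on the unit ball\<close>

theorem theorem3p1:
  assumes "CARD('n::finite) \<ge> 2"
  shows
    "(\<forall>(s::real) (C::real) (u :: real ^ 'n \<Rightarrow> real).
        0 < s \<and> s < 1 \<and> 1 \<le> C \<and>
        harnack_function (ball 0 1) s C u \<and> (\<forall>z\<in>ball 0 1. 0 < u z) \<longrightarrow>
        (\<forall>x\<in>ball 0 1. \<forall>y\<in>ball 0 1.
           let r = tanh (hyp_dist x y / 2);
               t = ln ((1 + r) / (1 - r)) / ln ((1 + s) / (1 - s))
           in u x \<le> C powr (1 + t) * u y)) \<and>
     (\<forall>(u :: real ^ 'n \<Rightarrow> real) (s::real) x y.
        harmonic_function_on (ball 0 1) u \<and> (\<forall>z\<in>ball 0 1. 0 < u z) \<and>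
        x \<in> ball 0 1 \<and> 0 < s \<and> s < 1 \<and> y \<in> sphere x (s * (1 - norm x)) \<longrightarrow>
        u x \<le> 1 / (1 - s\<^sup>2) * ((1 + s) / (1 - s)) ^ CARD('n) * u y \<and>
        s < exp (hyp_dist x y) - 1)"
proof (rule conjI; intro allI impI)
  fix s C :: real and u :: "real ^ 'n \<Rightarrow> real"
  assume "0 < s \<and> s < 1 \<and> 1 \<le> C \<and> harnack_function (ball 0 1) s C u \<and> (\<forall>z\<in>ball 0 1. 0 < u z)"
  then have u: "harnack_function (ball 0 1) s C u"
    by blast
  have "ln ((1 + s) / (1 - s)) = 2 * artanh s"
    by (simp add: artanh_def)
  moreover have "ln ((1 + tanh (d / 2)) / (1 - tanh (d / 2))) = d" for d :: real
    using artanh_tanh_real[of "d / 2"] by (simp add: artanh_def)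
  ultimately show "\<forall>x\<in>ball 0 1. \<forall>y\<in>ball 0 1.
      let r = tanh (hyp_dist x y / 2);
          t = ln ((1 + r) / (1 - r)) / ln ((1 + s) / (1 - s))
      in u x \<le> C powr (1 + t) * u y"
    using harnack_function_hyp_dist[OF u] by (simp add: Let_def)
next
  fix u :: "real ^ 'n \<Rightarrow> real" and s :: real and x y :: "real ^ 'n"
  assume "harmonic_function_on (ball 0 1) u \<and> (\<forall>z\<in>ball 0 1. 0 < u z) \<and>
    x \<in> ball 0 1 \<and> 0 < s \<and> s < 1 \<and> y \<in> sphere x (s * (1 - norm x))"
  then have u: "harmonic_function_on (ball 0 1) u" and pos: "\<And>z. z \<in> ball 0 1 \<Longrightarrow> 0 < u z"
    and x: "x \<in> ball 0 1" and s: "0 < s" "s < 1" and xy: "dist x y = s * (1 - norm x)"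
    by auto
  let ?n = "CARD('n)"
  have R: "0 < 1 - norm x"
    using x by simp
  have sub: "ball x (1 - norm x) \<subseteq> ball 0 1"
    by (rule ball_subset_ball_iff[THEN iffD2]) (simp add: dist_norm)
  have "s * (1 - norm x) < 1 - norm x"
    using R s by simp
  then have "y \<in> ball x (1 - norm x)"
    using xy by simp
  then have y: "y \<in> ball 0 1"
    using sub by blast
  have "(1 - s) ^ ?n * u x \<le> u y"
    by (rule harmonic_harnack[OF u less_imp_le[OF pos] sub R s xy])
  then have "u x \<le> 1 / (1 - s) ^ ?n * u y"
    using s by (simp add: pos_le_divide_eq mult.commute)
  also have "\<dots> \<le> 1 / (1 - s\<^sup>2) * ((1 + s) / (1 - s)) ^ ?n * u y"
  proof (intro mult_right_mono less_imp_le[OF pos[OF y]])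
    have s2: "0 < 1 - s\<^sup>2" "1 - s\<^sup>2 \<le> 1"
      using s by (simp_all add: abs_square_less_1)
    have "1 / (1 - s) ^ ?n \<le> ((1 + s) / (1 - s)) ^ ?n"
      unfolding power_one_over[symmetric] using s by (intro power_mono divide_right_mono) auto
    also have "\<dots> \<le> 1 / (1 - s\<^sup>2) * ((1 + s) / (1 - s)) ^ ?n"
      using s s2 mult_right_mono[of 1 "1 / (1 - s\<^sup>2)" "((1 + s) / (1 - s)) ^ ?n"] by simp
    finally show "1 / (1 - s) ^ ?n \<le> 1 / (1 - s\<^sup>2) * ((1 + s) / (1 - s)) ^ ?n" .
  qed
  finally have "u x \<le> 1 / (1 - s\<^sup>2) * ((1 + s) / (1 - s)) ^ ?n * u y" .
  moreover have "s < exp (hyp_dist x y) - 1"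
  proof -
    have "ln (1 + s) < hyp_dist x y"
      using xy by (intro hyp_dist_gt_ln[OF x y s(1)]) (simp add: dist_norm)
    then have "exp (ln (1 + s)) < exp (hyp_dist x y)"
      by (simp only: exp_less_cancel_iff)
    then show ?thesis
      using s by simp
  qed
  ultimately show "u x \<le> 1 / (1 - s\<^sup>2) * ((1 + s) / (1 - s)) ^ ?n * u y \<and> s < exp (hyp_dist x y) - 1" ..
qed

end
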